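(* Let $k$ be a field, let $\mathcal{C},\mathcal{D}$ be finite categories, let $S:\mathcal{D}\to k\text{-}\mathrm{Alg}$ be a precosheaf of $k$-algebras, and let $\boldsymbol{s}:\mathcal{D}\to\mathcal{C}$ be a covariant functor that is injective on objects and surjective on morphisms. Then $\mathrm{IndT}^{\mathcal{C}}_{\boldsymbol{s},\mathcal{D}}(S)$ is a precosheaf of $k$-algebras on $\mathcal{C}$.
   Context: Conventions. A finite category is one with finitely many morphisms. For a morphism $f:x\to y$ write $\mathrm{d}(f)=x$, $\mathrm{c}(f)=y$. A $k$-algebra is a unital associative $k$-algebra; $k\text{-}\mathrm{Alg}$ is the category of $k$-algebras with unital homomorphisms. A precosheaf of $k$-algebras on $\mathcal{D}$ is a covariant functor $\mathcal{D}\to k\text{-}\mathrm{Alg}$. The category algebra $k\mathcal{C}$ has $k$-basis $\mathrm{Mor}\,\mathcal{C}$, with $g\cdot f=g\circ f$ if $\mathrm{d}(g)=\mathrm{c}(f)$ and $0$ otherwise. For $f\in\mathrm{Mor}\,\mathcal{D}$ put $[f]=\{g\in\mathrm{Mor}\,\mathcal{D}\mid\boldsymbol{s}(g)=\boldsymbol{s}(f)\}$; since $\boldsymbol{s}$ is injective on objects, all elements of $[f]$ have the same domain and the same codomain. The functor $\boldsymbol{s}$ is bijective on objects. For $x\in\mathrm{Ob}\,\mathcal{D}$ let $M_S(x)$ be the $k$-subspace of all $m\in S(x)$ such that $S(f)(m)=S(g)(m)$ for all $f\in\mathrm{Mor}\,\mathcal{D}$ with $\mathrm{d}(f)=x$ and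 all $g\in[f]$. Let $\overline{M}_S=\bigoplus_{x\in\mathrm{Ob}\,\mathcal{D}}M_S(x)$, with component-wise multiplication (a subalgebra of $\prod_x S(x)$). It is a left $k\mathcal{C}$-module via: for $h\in\mathrm{Mor}\,\mathcal{C}$, $m\in M_S(x)$, $h\cdot m=S(f)(m)$ if there is $f\in\mathrm{Mor}\,\mathcal{D}$ with $\boldsymbol{s}(f)=h$ and $\mathrm{d}(f)=x$, and $h\cdot m=0$ otherwise. Surjective Turull's induction. $\mathrm{IndT}^{\mathcal{C}}_{\boldsymbol{s},\mathcal{D}}(S):\mathcal{C}\to k\text{-}\mathrm{Vect}$ is the functor (to $k$-vector spaces) with $$\mathrm{IndT}^{\mathcal{C}}_{\boldsymbol{s},\mathcal{D}}(S)(x')=1_{x'}\cdot\overline{M}_S\quad(x'\in\mathrm{Ob}\,\mathcal{C}),\qquad \mathrm{IndT}^{\mathcal{C}}_{\boldsymbol{s},\mathcal{D}}(S)(g):1_{x'}\cdot\overline{M}_S\to1_{y'}\cdot\overline{M}_S,\ m\mapsto g\cdot m,$$ for $g\in\mathrm{Hom}_{\mathcal{C}}(x',y')$. The multiplication on $1_{x'}\cdot\overline{M}_S$ is the restriction of the component-wise multiplication of $\overline{M}_S$. The claim means that with this multiplication the values are unital $k$-algebras and the maps $m\mapsto g\cdot m$ are unital $k$-algebra homomorphisms, so that the functor takes values in $k\text{-}\mathrm{Alg}$. *)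

theory Defs
  imports "HOL-Algebra.Module" "HOL-Algebra.Ring"
begin

section \<open>Categories and functors\<close>

record ('o, 'm) cat =
  Ob :: "'o set"
  Mor :: "'m set"
  Dom :: "'m \<Rightarrow> 'o"
  Cod :: "'m \<Rightarrow> 'o"
  Ide :: "'o \<Rightarrow> 'm"
  Comp :: "'m \<Rightarrow> 'm \<Rightarrow> 'm"

text \<open>\<open>Comp C g f\<close> is "first \<open>f\<close>, then \<open>g\<close>"; it is constrained only where \<open>Dom C g = Cod C f\<close>.\<close>

locale category =
  fixes C :: "('o, 'm) cat"
  assumes Dom_closed: "f \<in> Mor C \<Longrightarrow> Dom C f \<in> Ob C"
    and Cod_closed: "f \<in> Mor C \<Longrightarrow> Cod C f \<in> Ob C"
    and Ide_closed: "x \<in> Ob C \<Longrightarrow> Ide C x \<in> Mor C"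
    and Dom_Ide: "x \<in> Ob C \<Longrightarrow> Dom C (Ide C x) = x"
    and Cod_Ide: "x \<in> Ob C \<Longrightarrow> Cod C (Ide C x) = x"
    and Comp_closed: "\<lbrakk>f \<in> Mor C; g \<in> Mor C; Dom C g = Cod C f\<rbrakk> \<Longrightarrow> Comp C g f \<in> Mor C"
    and Dom_Comp: "\<lbrakk>f \<in> Mor C; g \<in> Mor C; Dom C g = Cod C f\<rbrakk> \<Longrightarrow> Dom C (Comp C g f) = Dom C f"
    and Cod_Comp: "\<lbrakk>f \<in> Mor C; g \<in> Mor C; Dom C g = Cod C f\<rbrakk> \<Longrightarrow> Cod C (Comp C g f) = Cod C g"
    and Comp_Ide_right: "f \<in> Mor C \<Longrightarrow> Comp C f (Ide C (Dom C f)) = f"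
    and Comp_Ide_left: "f \<in> Mor C \<Longrightarrow> Comp C (Ide C (Cod C f)) f = f"
    and Comp_assoc: "\<lbrakk>f \<in> Mor C; g \<in> Mor C; h \<in> Mor C; Dom C g = Cod C f; Dom C h = Cod C g\<rbrakk>
          \<Longrightarrow> Comp C h (Comp C g f) = Comp C (Comp C h g) f"

locale finite_category = category C for C :: "('o, 'm) cat" +
  assumes finite_Mor: "finite (Mor C)"

record ('o, 'm, 'p, 'n) fun_data =
  fob :: "'o \<Rightarrow> 'p"
  fmor :: "'m \<Rightarrow> 'n"

locale covariant_functor =
  source: category C + target: category D
  for C :: "('o, 'm) cat" and D :: "('p, 'n) cat" +
  fixes F :: "('o, 'm, 'p, 'n) fun_data"
  assumes fob_closed: "x \<in> Ob C \<Longrightarrow> fob F x \<in> Ob D"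
    and fmor_closed: "f \<in> Mor C \<Longrightarrow> fmor F f \<in> Mor D"
    and fmor_Dom: "f \<in> Mor C \<Longrightarrow> Dom D (fmor F f) = fob F (Dom C f)"
    and fmor_Cod: "f \<in> Mor C \<Longrightarrow> Cod D (fmor F f) = fob F (Cod C f)"
    and fmor_Ide: "x \<in> Ob C \<Longrightarrow> fmor F (Ide C x) = Ide D (fob F x)"
    and fmor_Comp: "\<lbrakk>f \<in> Mor C; g \<in> Mor C; Dom C g = Cod C f\<rbrakk>
          \<Longrightarrow> fmor F (Comp C g f) = Comp D (fmor F g) (fmor F f)"


section \<open>The category of algebras over a field\<close>

text \<open>The library locale \<open>algebra\<close> only covers commutative algebras.\<close>

definition k_algebra :: "('k, 'c) ring_scheme \<Rightarrow> ('k, 'a, 'd) module_scheme \<Rightarrow> bool" where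
  "k_algebra K A \<longleftrightarrow> module K A \<and> ring A \<and>
     (\<forall>a \<in> carrier K. \<forall>x \<in> carrier A. \<forall>y \<in> carrier A.
        (a \<odot>\<^bsub>A\<^esub> x) \<otimes>\<^bsub>A\<^esub> y = a \<odot>\<^bsub>A\<^esub> (x \<otimes>\<^bsub>A\<^esub> y) \<and>
        x \<otimes>\<^bsub>A\<^esub> (a \<odot>\<^bsub>A\<^esub> y) = a \<odot>\<^bsub>A\<^esub> (x \<otimes>\<^bsub>A\<^esub> y))"

text \<open>Elements of \<open>ring_hom\<close> preserve the unit.\<close>

definition k_algebra_hom ::
    "('k, 'c) ring_scheme \<Rightarrow> ('k, 'a, 'd) module_scheme \<Rightarrow> ('k, 'b, 'e) module_scheme \<Rightarrow> ('a \<Rightarrow> 'b) set" where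
  "k_algebra_hom K A B =
     {f \<in> ring_hom A B. \<forall>a \<in> carrier K. \<forall>x \<in> carrier A. f (a \<odot>\<^bsub>A\<^esub> x) = a \<odot>\<^bsub>B\<^esub> f x}"

text \<open>Morphisms carry their domain and codomain. Their underlying maps are required to be
  \<open>undefined\<close> outside the carrier of the domain, so that equality of morphisms is equality of maps
  on that carrier. All algebras have their carriers inside one type \<open>'a\<close>.\<close>

type_synonym ('k, 'a) arr = "('k, 'a) module \<times> ('a \<Rightarrow> 'a) \<times> ('k, 'a) module"

definition arr_map :: "('k, 'a) arr \<Rightarrow> 'a \<Rightarrow> 'a" where
  "arr_map \<phi> = fst (snd \<phi>)"

definition kAlg :: "('k, 'c) ring_scheme \<Rightarrow> (('k, 'a) module, ('k, 'a) arr) cat" where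
  "kAlg K =
     \<lparr>Ob = {A. k_algebra K A},
      Mor = {(A, f, B). k_algebra K A \<and> k_algebra K B \<and>
                        f \<in> k_algebra_hom K A B \<and> f \<in> extensional (carrier A)},
      Dom = (\<lambda>(A, f, B). A),
      Cod = (\<lambda>(A, f, B). B),
      Ide = (\<lambda>A. (A, \<lambda>x \<in> carrier A. x, A)),
      Comp = (\<lambda>(B', g, C) (A, f, B). (A, compose (carrier A) g f, C))\<rparr>"

lemma category_kAlg:
  fixes K :: "('k, 'c) ring_scheme"
  shows "category (kAlg K :: (('k, 'a) module, ('k, 'a) arr) cat)"
proof -
  have id: "(\<lambda>x \<in> carrier A. x) \<in> k_algebra_hom K A A" if "k_algebra K A" for A :: "('k, 'a) module"
  proof -
    interpret A: module K A using that by (simp add: k_algebra_def)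
    interpret R: ring A using that by (simp add: k_algebra_def)
    show ?thesis by (simp add: k_algebra_hom_def ring_hom_def)
  qed
  have comp: "compose (carrier A) g f \<in> k_algebra_hom K A B'"
    if "k_algebra K A" "f \<in> k_algebra_hom K A B" "g \<in> k_algebra_hom K B B'"
    for A B B' :: "('k, 'a) module" and f g
  proof -
    interpret A: module K A using that by (simp add: k_algebra_def)
    interpret R: ring A using that by (simp add: k_algebra_def)
    show ?thesis using that(2,3)
      by (auto simp add: k_algebra_hom_def ring_hom_def compose_def Pi_iff)
  qed
  have maps: "f \<in> carrier A \<rightarrow> carrier B" if "f \<in> k_algebra_hom K A B"
    for A B :: "('k, 'a) module" and f
    using that by (simp add: k_algebra_hom_def ring_hom_def)
  show ?thesis
    by standard
      (auto simp: kAlg_def id comp compose_assoc[OF maps] intro: compose_Id Id_compose dest: maps)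
qed

abbreviation precosheaf ::
    "('k, 'c) ring_scheme \<Rightarrow> ('o, 'm) cat \<Rightarrow> ('o, 'm, ('k, 'a) module, ('k, 'a) arr) fun_data \<Rightarrow> bool" where
  "precosheaf K D S \<equiv> covariant_functor D (kAlg K) S"


section \<open>Surjective Turull's induction\<close>

text \<open>The class \<open>[f]\<close> of \<open>f\<close>.\<close>

definition fibre :: "('o, 'm) cat \<Rightarrow> ('o, 'm, 'p, 'n) fun_data \<Rightarrow> 'm \<Rightarrow> 'm set" where
  "fibre D s f = {g \<in> Mor D. fmor s g = fmor s f}"

definition M_S ::
    "('o, 'm) cat \<Rightarrow> ('o, 'm, 'p, 'n) fun_data \<Rightarrow> ('o, 'm, ('k, 'a) module, ('k, 'a) arr) fun_data
      \<Rightarrow> 'o \<Rightarrow> 'a set" where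
  "M_S D s S x =
     {m \<in> carrier (fob S x).
        \<forall>f \<in> Mor D. Dom D f = x \<longrightarrow>
          (\<forall>g \<in> fibre D s f. arr_map (fmor S f) m = arr_map (fmor S g) m)}"

definition prod_algebra :: "'i set \<Rightarrow> ('i \<Rightarrow> ('k, 'a) module) \<Rightarrow> ('k, 'i \<Rightarrow> 'a) module" where
  "prod_algebra I A =
     \<lparr>carrier = (\<Pi>\<^sub>E i \<in> I. carrier (A i)),
      mult = (\<lambda>a b. \<lambda>i \<in> I. a i \<otimes>\<^bsub>A i\<^esub> b i),
      one = (\<lambda>i \<in> I. \<one>\<^bsub>A i\<^esub>),
      zero = (\<lambda>i \<in> I. \<zero>\<^bsub>A i\<^esub>),
      add = (\<lambda>a b. \<lambda>i \<in> I. a i \<oplus>\<^bsub>A i\<^esub> b i),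
      smult = (\<lambda>c a. \<lambda>i \<in> I. c \<odot>\<^bsub>A i\<^esub> a i)\<rparr>"

text \<open>As \<open>Ob D\<close> is finite, the direct sum of the \<open>M_S D s S x\<close> is the set of all families.\<close>

definition Mbar ::
    "('o, 'm) cat \<Rightarrow> ('o, 'm, 'p, 'n) fun_data \<Rightarrow> ('o, 'm, ('k, 'a) module, ('k, 'a) arr) fun_data
      \<Rightarrow> ('k, 'o \<Rightarrow> 'a) module" where
  "Mbar D s S = (prod_algebra (Ob D) (fob S)) \<lparr>carrier := (\<Pi>\<^sub>E x \<in> Ob D. M_S D s S x)\<rparr>"

definition incl ::
    "('o, 'm) cat \<Rightarrow> ('o, 'm, ('k, 'a) module, ('k, 'a) arr) fun_data \<Rightarrow> 'o \<Rightarrow> 'a \<Rightarrow> 'o \<Rightarrow> 'a" where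
  "incl D S x m = (\<lambda>z \<in> Ob D. if z = x then m else \<zero>\<^bsub>fob S z\<^esub>)"

text \<open>The product \<open>h \<cdot> m\<close> for a morphism \<open>h\<close> of \<open>C\<close> and \<open>m \<in> M_S D s S x\<close>. By definition of \<open>M_S\<close> it does
  not depend on the chosen \<open>f\<close>.\<close>

definition act_comp ::
    "('o, 'm) cat \<Rightarrow> ('o, 'm, 'p, 'n) fun_data \<Rightarrow> ('o, 'm, ('k, 'a) module, ('k, 'a) arr) fun_data
      \<Rightarrow> 'n \<Rightarrow> 'o \<Rightarrow> 'a \<Rightarrow> 'o \<Rightarrow> 'a" where
  "act_comp D s S h x m =
     (if \<exists>f \<in> Mor D. fmor s f = h \<and> Dom D f = x
      then let f = (SOME f. f \<in> Mor D \<and> fmor s f = h \<and> Dom D f = x)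
           in incl D S (Cod D f) (arr_map (fmor S f) m)
      else \<zero>\<^bsub>Mbar D s S\<^esub>)"

text \<open>The action of a basis element \<open>h\<close> of the category algebra on the direct sum, extended additively
  from the summands.\<close>

definition act ::
    "('o, 'm) cat \<Rightarrow> ('o, 'm, 'p, 'n) fun_data \<Rightarrow> ('o, 'm, ('k, 'a) module, ('k, 'a) arr) fun_data
      \<Rightarrow> 'n \<Rightarrow> ('o \<Rightarrow> 'a) \<Rightarrow> 'o \<Rightarrow> 'a" where
  "act D s S h a = (\<Oplus>\<^bsub>Mbar D s S\<^esub> x \<in> Ob D. act_comp D s S h x (a x))"

text \<open>The operations of \<open>1\<^sub>x\<^sub>' \<cdot> Mbar\<close> are those of \<open>Mbar\<close>. Its unit is not that of \<open>Mbar\<close>, but the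
  projection \<open>1\<^sub>x\<^sub>' \<cdot> 1\<close> of it.\<close>

definition IndT_ob ::
    "('p, 'n) cat \<Rightarrow> ('o, 'm) cat \<Rightarrow> ('o, 'm, 'p, 'n) fun_data
      \<Rightarrow> ('o, 'm, ('k, 'a) module, ('k, 'a) arr) fun_data \<Rightarrow> 'p \<Rightarrow> ('k, 'o \<Rightarrow> 'a) module" where
  "IndT_ob C D s S x' =
     (Mbar D s S)
       \<lparr>carrier := act D s S (Ide C x') ` carrier (Mbar D s S),
        one := act D s S (Ide C x') \<one>\<^bsub>Mbar D s S\<^esub>\<rparr>"

definition IndT ::
    "('p, 'n) cat \<Rightarrow> ('o, 'm) cat \<Rightarrow> ('o, 'm, 'p, 'n) fun_data
      \<Rightarrow> ('o, 'm, ('k, 'a) module, ('k, 'a) arr) fun_data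
      \<Rightarrow> ('p, 'n, ('k, 'o \<Rightarrow> 'a) module, ('k, 'o \<Rightarrow> 'a) arr) fun_data" where
  "IndT C D s S =
     \<lparr>fob = IndT_ob C D s S,
      fmor = (\<lambda>g. (IndT_ob C D s S (Dom C g),
                   \<lambda>m \<in> carrier (IndT_ob C D s S (Dom C g)). act D s S g m,
                   IndT_ob C D s S (Cod C g)))\<rparr>"

end

theory Submission
  imports Defs
begin

text \<open>If \<open>f : x \<rightarrow> y\<close> is a lift of \<open>h\<close> along \<open>s\<close>, then \<open>h\<close> acts on \<open>Mbar\<close> by sending a family
  \<open>a\<close> to the family concentrated at \<open>y\<close> with entry \<open>S(f)(a x)\<close>: injectivity on objects leaves \<open>x\<close>
  as the only summand on which \<open>h\<close> is non-zero. Hence \<open>1\<^sub>x\<^sub>' \<cdot> Mbar\<close> is a copy of the subalgebra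
  \<open>M_S x\<close> of \<open>S(x)\<close>, where \<open>x\<close> is the object above \<open>x'\<close>, and \<open>h\<close> acts as the restriction of \<open>S(f)\<close>,
  which maps \<open>M_S x\<close> to \<open>M_S y\<close> because \<open>s\<close> is compatible with composition.\<close>

section \<open>Transport of algebra structure and algebra homomorphisms\<close>

text \<open>The algebra axioms are equations, so they pass to the subalgebra \<open>N\<close> and
  then along any map that respects the operations. It will be applied with \<open>N\<close> the set
  \<open>M_S D s S x\<close> and \<open>\<phi>\<close> the inclusion into the direct sum.\<close>

lemma k_algebra_image:
  fixes A :: "('k, 'a, 'd) module_scheme" and B :: "('k, 'b, 'e) module_scheme"
  assumes A: "k_algebra K A"
    and N: "N \<subseteq> carrier A" "\<one>\<^bsub>A\<^esub> \<in> N" "\<zero>\<^bsub>A\<^esub> \<in> N"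
      "\<And>a b. \<lbrakk>a \<in> N; b \<in> N\<rbrakk> \<Longrightarrow> a \<oplus>\<^bsub>A\<^esub> b \<in> N"
      "\<And>a b. \<lbrakk>a \<in> N; b \<in> N\<rbrakk> \<Longrightarrow> a \<otimes>\<^bsub>A\<^esub> b \<in> N"
      "\<And>c a. \<lbrakk>c \<in> carrier K; a \<in> N\<rbrakk> \<Longrightarrow> c \<odot>\<^bsub>A\<^esub> a \<in> N"
    and B: "carrier B = \<phi> ` N" "\<one>\<^bsub>B\<^esub> = \<phi> \<one>\<^bsub>A\<^esub>" "\<zero>\<^bsub>B\<^esub> = \<phi> \<zero>\<^bsub>A\<^esub>"
      "\<And>a b. \<lbrakk>a \<in> N; b \<in> N\<rbrakk> \<Longrightarrow> \<phi> a \<oplus>\<^bsub>B\<^esub> \<phi> b = \<phi> (a \<oplus>\<^bsub>A\<^esub> b)"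
      "\<And>a b. \<lbrakk>a \<in> N; b \<in> N\<rbrakk> \<Longrightarrow> \<phi> a \<otimes>\<^bsub>B\<^esub> \<phi> b = \<phi> (a \<otimes>\<^bsub>A\<^esub> b)"
      "\<And>c a. \<lbrakk>c \<in> carrier K; a \<in> N\<rbrakk> \<Longrightarrow> c \<odot>\<^bsub>B\<^esub> \<phi> a = \<phi> (c \<odot>\<^bsub>A\<^esub> a)"
  shows "k_algebra K B"
proof -
  interpret R: ring A using A by (simp add: k_algebra_def)
  interpret M: module K A using A by (simp add: k_algebra_def)
  have inN: "a \<in> carrier A" if "a \<in> N" for a using that N(1) by blast
  \<comment> \<open>Additive inverses inside \<open>N\<close> are multiples by the scalar -1, so
    closure under scalar multiplication supplies them.\<close>
  have inv: "\<exists>b\<in>N. b \<oplus>\<^bsub>A\<^esub> a = \<zero>\<^bsub>A\<^esub>" if "a \<in> N" for a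
  proof
    show "(\<ominus>\<^bsub>K\<^esub> \<one>\<^bsub>K\<^esub>) \<odot>\<^bsub>A\<^esub> a \<in> N" using that N(6) by simp
    show "(\<ominus>\<^bsub>K\<^esub> \<one>\<^bsub>K\<^esub>) \<odot>\<^bsub>A\<^esub> a \<oplus>\<^bsub>A\<^esub> a = \<zero>\<^bsub>A\<^esub>"
      using inN[OF that] by (simp add: M.smult_l_minus R.l_neg)
  qed
  have ab: "abelian_group B"
  proof (rule abelian_groupI)
    show "\<exists>y\<in>carrier B. y \<oplus>\<^bsub>B\<^esub> x = \<zero>\<^bsub>B\<^esub>" if x: "x \<in> carrier B" for x
    proof -
      obtain a where a: "a \<in> N" "x = \<phi> a" using x B(1) by blast
      obtain b where "b \<in> N" "b \<oplus>\<^bsub>A\<^esub> a = \<zero>\<^bsub>A\<^esub>" using inv[OF a(1)] by blast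
      then show ?thesis using a(1) by (intro bexI[of _ "\<phi> b"]) (simp_all add: a(2) B)
    qed
  qed (auto simp: B N inN R.a_ac)
  have "monoid B"
    by (rule monoidI) (auto simp: B N inN R.m_assoc)
  then have "ring B"
    by (intro ringI[OF ab]) (auto simp: B N inN R.l_distr R.r_distr)
  moreover have "module K B"
    by (rule moduleI[OF M.is_cring ab])
      (auto simp: B N inN M.smult_l_distr M.smult_r_distr M.smult_assoc1)
  moreover have "(c \<odot>\<^bsub>A\<^esub> a) \<otimes>\<^bsub>A\<^esub> b = c \<odot>\<^bsub>A\<^esub> (a \<otimes>\<^bsub>A\<^esub> b)" "a \<otimes>\<^bsub>A\<^esub> (c \<odot>\<^bsub>A\<^esub> b) = c \<odot>\<^bsub>A\<^esub> (a \<otimes>\<^bsub>A\<^esub> b)"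
    if "c \<in> carrier K" "a \<in> N" "b \<in> N" for c a b
    using A that inN by (auto simp: k_algebra_def)
  ultimately show ?thesis
    by (auto simp: k_algebra_def B N)
qed

lemma k_algebra_homD:
  assumes "f \<in> k_algebra_hom K A B"
  shows "x \<in> carrier A \<Longrightarrow> f x \<in> carrier B"
    and "\<lbrakk>x \<in> carrier A; y \<in> carrier A\<rbrakk> \<Longrightarrow> f (x \<oplus>\<^bsub>A\<^esub> y) = f x \<oplus>\<^bsub>B\<^esub> f y"
    and "\<lbrakk>x \<in> carrier A; y \<in> carrier A\<rbrakk> \<Longrightarrow> f (x \<otimes>\<^bsub>A\<^esub> y) = f x \<otimes>\<^bsub>B\<^esub> f y"
    and "f \<one>\<^bsub>A\<^esub> = \<one>\<^bsub>B\<^esub>"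
    and "\<lbrakk>c \<in> carrier K; x \<in> carrier A\<rbrakk> \<Longrightarrow> f (c \<odot>\<^bsub>A\<^esub> x) = c \<odot>\<^bsub>B\<^esub> f x"
  using assms by (auto simp: k_algebra_hom_def ring_hom_def)

lemma k_algebra_hom_zero:
  assumes "k_algebra K A" "k_algebra K B" "f \<in> k_algebra_hom K A B"
  shows "f \<zero>\<^bsub>A\<^esub> = \<zero>\<^bsub>B\<^esub>"
  using assms by (intro ring_hom_zero) (auto simp: k_algebra_hom_def k_algebra_def)

section \<open>The precosheaf \<open>S\<close> as a family of algebras and maps\<close>

locale turull_induction =
  source: category D + target: category C + S: covariant_functor D "kAlg K" S +
  s: covariant_functor D C s
  for K :: "('k, 'c) ring_scheme"
    and C :: "('p, 'n) cat"
    and D :: "('o, 'm) cat"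
    and S :: "('o, 'm, ('k, 'a) module, ('k, 'a) arr) fun_data"
    and s :: "('o, 'm, 'p, 'n) fun_data" +
  assumes finite_Ob: "finite (Ob D)"
    and inj_Ob: "inj_on (fob s) (Ob D)"
    and surj_Mor: "fmor s ` Mor D = Mor C"
begin

abbreviation S_map :: "'m \<Rightarrow> 'a \<Rightarrow> 'a" where
  "S_map f \<equiv> arr_map (fmor S f)"

lemma k_algebra_S: "x \<in> Ob D \<Longrightarrow> k_algebra K (fob S x)"
  using S.fob_closed by (simp add: kAlg_def)

lemma ring_S: "x \<in> Ob D \<Longrightarrow> ring (fob S x)"
  using k_algebra_S by (simp add: k_algebra_def)

lemma module_S: "x \<in> Ob D \<Longrightarrow> module K (fob S x)"
  using k_algebra_S by (simp add: k_algebra_def)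

text \<open>An arrow of \<open>kAlg K\<close> carries its two end algebras. Functoriality of
  \<open>S\<close> determines both, so the underlying map \<open>S_map f\<close> is the only further
  datum.\<close>

lemma fmor_S:
  assumes "f \<in> Mor D"
  shows "fmor S f = (fob S (Dom D f), S_map f, fob S (Cod D f))"
  using S.fmor_closed[OF assms] S.fmor_Dom[OF assms] S.fmor_Cod[OF assms]
  by (auto simp: kAlg_def arr_map_def)

lemma S_map_hom:
  assumes "f \<in> Mor D"
  shows "S_map f \<in> k_algebra_hom K (fob S (Dom D f)) (fob S (Cod D f))"
  using S.fmor_closed[OF assms] by (subst (asm) fmor_S[OF assms]) (simp add: kAlg_def)

lemmas S_map_simps = k_algebra_homD[OF S_map_hom]

lemma S_map_zero: "f \<in> Mor D \<Longrightarrow> S_map f \<zero>\<^bsub>fob S (Dom D f)\<^esub> = \<zero>\<^bsub>fob S (Cod D f)\<^esub>"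
  using k_algebra_hom_zero[OF k_algebra_S k_algebra_S S_map_hom]
  by (simp add: source.Dom_closed source.Cod_closed)

text \<open>Identities and composites in \<open>kAlg K\<close> are restricted to carriers, so here
  and in \<open>S_map_Comp\<close> the law is claimed only for elements of the source
  algebra.\<close>

lemma S_map_Ide:
  assumes "x \<in> Ob D" "m \<in> carrier (fob S x)"
  shows "S_map (Ide D x) m = m"
  using S.fmor_Ide[OF assms(1)] assms(2) by (simp add: kAlg_def arr_map_def)

lemma S_map_Comp:
  assumes "f \<in> Mor D" "g \<in> Mor D" "Dom D g = Cod D f" "m \<in> carrier (fob S (Dom D f))"
  shows "S_map (Comp D g f) m = S_map g (S_map f m)"
proof -
  have "fmor S (Comp D g f) = Comp (kAlg K) (fob S (Dom D g), S_map g, fob S (Cod D g))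
      (fob S (Dom D f), S_map f, fob S (Cod D f))"
    using S.fmor_Comp[OF assms(1-3)] fmor_S assms(1,2) by simp
  then show ?thesis using assms(4) by (simp add: kAlg_def arr_map_def compose_def)
qed

section \<open>Fibres of \<open>s\<close> and the subalgebras \<open>M_S\<close>\<close>

text \<open>Equal images under \<open>s\<close> have equal ends in \<open>C\<close>, and injectivity
  of \<open>s\<close> on objects lifts these equalities to \<open>D\<close>.\<close>

lemma fibreD:
  assumes "f \<in> Mor D" "g \<in> fibre D s f"
  shows "g \<in> Mor D" "fmor s g = fmor s f" "Dom D g = Dom D f" "Cod D g = Cod D f"
proof -
  show g: "g \<in> Mor D" "fmor s g = fmor s f" using assms(2) by (auto simp: fibre_def)
  show "Dom D g = Dom D f"
    using s.fmor_Dom[OF assms(1)] s.fmor_Dom[OF g(1)] g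
    by (intro inj_onD[OF inj_Ob]) (simp_all add: source.Dom_closed assms(1))
  show "Cod D g = Cod D f"
    using s.fmor_Cod[OF assms(1)] s.fmor_Cod[OF g(1)] g
    by (intro inj_onD[OF inj_Ob]) (simp_all add: source.Cod_closed assms(1))
qed

lemma M_S_carrier: "m \<in> M_S D s S x \<Longrightarrow> m \<in> carrier (fob S x)"
  by (simp add: M_S_def)

text \<open>By \<open>fibreD\<close>, the competing morphisms may be taken to be parallel, so that
  the two values to be compared lie in the same algebra.\<close>

lemma M_S_I:
  assumes "m \<in> carrier (fob S x)"
    "\<And>f g. \<lbrakk>f \<in> Mor D; g \<in> Mor D; fmor s g = fmor s f; Dom D f = x; Dom D g = x; Cod D g = Cod D f\<rbrakk>
      \<Longrightarrow> S_map f m = S_map g m"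
  shows "m \<in> M_S D s S x"
proof -
  have "S_map f m = S_map g m" if "f \<in> Mor D" "Dom D f = x" "g \<in> fibre D s f" for f g
    using assms(2)[of f g] fibreD[OF that(1,3)] that(1,2) by simp
  then show ?thesis using assms(1) by (simp add: M_S_def)
qed

lemma M_S_D:
  assumes "m \<in> M_S D s S x" "f \<in> Mor D" "g \<in> Mor D" "fmor s g = fmor s f" "Dom D f = x"
  shows "S_map f m = S_map g m"
proof -
  have "g \<in> fibre D s f" using assms(3,4) by (simp add: fibre_def)
  then show ?thesis using assms(1,2,5) unfolding M_S_def by blast
qed

text \<open>\<open>M_S D s S x\<close> is the common equalizer of pairs of algebra homomorphisms
  \<open>S_map f\<close>, \<open>S_map g\<close> with \<open>f\<close> and \<open>g\<close> in one
  fibre, hence a unital subalgebra.\<close>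

lemma M_S_closed:
  assumes x: "x \<in> Ob D"
  shows "\<one>\<^bsub>fob S x\<^esub> \<in> M_S D s S x"
    and "\<zero>\<^bsub>fob S x\<^esub> \<in> M_S D s S x"
    and "\<lbrakk>a \<in> M_S D s S x; b \<in> M_S D s S x\<rbrakk> \<Longrightarrow> a \<oplus>\<^bsub>fob S x\<^esub> b \<in> M_S D s S x"
    and "\<lbrakk>a \<in> M_S D s S x; b \<in> M_S D s S x\<rbrakk> \<Longrightarrow> a \<otimes>\<^bsub>fob S x\<^esub> b \<in> M_S D s S x"
    and "\<lbrakk>c \<in> carrier K; a \<in> M_S D s S x\<rbrakk> \<Longrightarrow> c \<odot>\<^bsub>fob S x\<^esub> a \<in> M_S D s S x"
proof -
  interpret R: ring "fob S x" using x by (rule ring_S)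
  interpret M: module K "fob S x" using x by (rule module_S)
  have eq: "S_map f a = S_map g a"
    if "a \<in> M_S D s S x" "f \<in> Mor D" "g \<in> Mor D" "fmor s g = fmor s f" "Dom D f = x" for a f g
    using M_S_D that by blast
  show "\<one>\<^bsub>fob S x\<^esub> \<in> M_S D s S x"
    by (rule M_S_I) (use S_map_simps(4) in \<open>simp_all, metis\<close>)
  show "\<zero>\<^bsub>fob S x\<^esub> \<in> M_S D s S x"
    by (rule M_S_I) (use S_map_zero in \<open>simp_all, metis\<close>)
  show "a \<oplus>\<^bsub>fob S x\<^esub> b \<in> M_S D s S x" if "a \<in> M_S D s S x" "b \<in> M_S D s S x"
  proof (rule M_S_I)
    fix f g assume "f \<in> Mor D" "g \<in> Mor D" "fmor s g = fmor s f" "Dom D f = x" "Dom D g = x"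
      "Cod D g = Cod D f"
    then show "S_map f (a \<oplus>\<^bsub>fob S x\<^esub> b) = S_map g (a \<oplus>\<^bsub>fob S x\<^esub> b)"
      using S_map_simps(2)[of f a b] S_map_simps(2)[of g a b] that eq[of a f g] eq[of b f g]
      by (simp add: M_S_carrier)
  qed (use that M_S_carrier in auto)
  show "a \<otimes>\<^bsub>fob S x\<^esub> b \<in> M_S D s S x" if "a \<in> M_S D s S x" "b \<in> M_S D s S x"
  proof (rule M_S_I)
    fix f g assume "f \<in> Mor D" "g \<in> Mor D" "fmor s g = fmor s f" "Dom D f = x" "Dom D g = x"
      "Cod D g = Cod D f"
    then show "S_map f (a \<otimes>\<^bsub>fob S x\<^esub> b) = S_map g (a \<otimes>\<^bsub>fob S x\<^esub> b)"
      using S_map_simps(3)[of f a b] S_map_simps(3)[of g a b] that eq[of a f g] eq[of b f g]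
      by (simp add: M_S_carrier)
  qed (use that M_S_carrier in auto)
  show "c \<odot>\<^bsub>fob S x\<^esub> a \<in> M_S D s S x" if "c \<in> carrier K" "a \<in> M_S D s S x"
  proof (rule M_S_I)
    fix f g assume "f \<in> Mor D" "g \<in> Mor D" "fmor s g = fmor s f" "Dom D f = x" "Dom D g = x"
      "Cod D g = Cod D f"
    then show "S_map f (c \<odot>\<^bsub>fob S x\<^esub> a) = S_map g (c \<odot>\<^bsub>fob S x\<^esub> a)"
      using S_map_simps(5)[of f c a] S_map_simps(5)[of g c a] that eq[of a f g]
      by (simp add: M_S_carrier)
  qed (use that M_S_carrier in auto)
qed

text \<open>If \<open>p\<close> and \<open>q\<close> lie in one fibre, then so do their composites
  with \<open>f\<close>, because \<open>s\<close> preserves composition. The condition on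
  \<open>m\<close> for these composites is the condition on \<open>S_map f m\<close> for
  \<open>p\<close> and \<open>q\<close>.\<close>

lemma S_map_M_S:
  assumes f: "f \<in> Mor D" and m: "m \<in> M_S D s S (Dom D f)"
  shows "S_map f m \<in> M_S D s S (Cod D f)"
proof (rule M_S_I)
  show "S_map f m \<in> carrier (fob S (Cod D f))"
    using S_map_simps(1)[OF f] m M_S_carrier by blast
next
  fix p q assume pq: "p \<in> Mor D" "q \<in> Mor D" "fmor s q = fmor s p" "Dom D p = Cod D f"
    "Dom D q = Cod D f"
  have "S_map (Comp D p f) m = S_map (Comp D q f) m"
    using pq f by (intro M_S_D[OF m]) (auto simp: source.Comp_closed source.Dom_Comp s.fmor_Comp)
  then show "S_map p (S_map f m) = S_map q (S_map f m)"
    using pq f m by (simp add: S_map_Comp M_S_carrier)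
qed

section \<open>The direct sum and the action of morphisms of \<open>C\<close>\<close>

lemma Mbar_simps:
  "carrier (Mbar D s S) = (\<Pi>\<^sub>E x \<in> Ob D. M_S D s S x)"
  "\<one>\<^bsub>Mbar D s S\<^esub> = (\<lambda>x \<in> Ob D. \<one>\<^bsub>fob S x\<^esub>)"
  "\<zero>\<^bsub>Mbar D s S\<^esub> = (\<lambda>x \<in> Ob D. \<zero>\<^bsub>fob S x\<^esub>)"
  "a \<oplus>\<^bsub>Mbar D s S\<^esub> b = (\<lambda>x \<in> Ob D. a x \<oplus>\<^bsub>fob S x\<^esub> b x)"
  "a \<otimes>\<^bsub>Mbar D s S\<^esub> b = (\<lambda>x \<in> Ob D. a x \<otimes>\<^bsub>fob S x\<^esub> b x)"
  "c \<odot>\<^bsub>Mbar D s S\<^esub> a = (\<lambda>x \<in> Ob D. c \<odot>\<^bsub>fob S x\<^esub> a x)"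
  by (simp_all add: Mbar_def prod_algebra_def)

lemma one_Mbar_closed: "\<one>\<^bsub>Mbar D s S\<^esub> \<in> carrier (Mbar D s S)"
  by (auto simp: Mbar_simps M_S_closed)

lemma abelian_monoid_S: "x \<in> Ob D \<Longrightarrow> abelian_monoid (fob S x)"
  using ring_S by (simp add: ring_def abelian_group_def)

text \<open>The action is a finite sum in \<open>Mbar D s S\<close>; the commutative monoid laws,
  checked componentwise, are what allows this sum to be evaluated.\<close>

lemma abelian_monoid_Mbar: "abelian_monoid (Mbar D s S)"
proof (rule abelian_monoidI)
  fix a b c
  assume abc: "a \<in> carrier (Mbar D s S)" "b \<in> carrier (Mbar D s S)" "c \<in> carrier (Mbar D s S)"
  have "a x \<in> carrier (fob S x)" "b x \<in> carrier (fob S x)" "c x \<in> carrier (fob S x)"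
    if "x \<in> Ob D" for x
    using abc that by (auto simp: Mbar_simps intro: M_S_carrier)
  then show "a \<oplus>\<^bsub>Mbar D s S\<^esub> b \<oplus>\<^bsub>Mbar D s S\<^esub> c = a \<oplus>\<^bsub>Mbar D s S\<^esub> (b \<oplus>\<^bsub>Mbar D s S\<^esub> c)"
    by (auto simp: Mbar_simps abelian_monoid.a_assoc[OF abelian_monoid_S] intro!: restrict_ext)
next
  fix a b
  assume ab: "a \<in> carrier (Mbar D s S)" "b \<in> carrier (Mbar D s S)"
  have "a x \<in> carrier (fob S x)" "b x \<in> carrier (fob S x)" if "x \<in> Ob D" for x
    using ab that by (auto simp: Mbar_simps intro: M_S_carrier)
  then show "a \<oplus>\<^bsub>Mbar D s S\<^esub> b = b \<oplus>\<^bsub>Mbar D s S\<^esub> a"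
    by (auto simp: Mbar_simps abelian_monoid.a_comm[OF abelian_monoid_S] intro!: restrict_ext)
next
  fix a
  assume a: "a \<in> carrier (Mbar D s S)"
  have "a x \<in> carrier (fob S x)" if "x \<in> Ob D" for x
    using a that by (auto simp: Mbar_simps intro: M_S_carrier)
  then have "\<zero>\<^bsub>Mbar D s S\<^esub> \<oplus>\<^bsub>Mbar D s S\<^esub> a = restrict a (Ob D)"
    by (auto simp: Mbar_simps abelian_monoid.l_zero[OF abelian_monoid_S] intro!: restrict_ext)
  \<comment> \<open>Families in the carrier are undefined outside \<open>Ob D\<close>, so
    restricting changes nothing.\<close>
  also have "\<dots> = a" using a by (auto simp: Mbar_simps PiE_restrict)
  finally show "\<zero>\<^bsub>Mbar D s S\<^esub> \<oplus>\<^bsub>Mbar D s S\<^esub> a = a" .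
qed (auto simp: Mbar_simps M_S_closed PiE_mem)

lemma incl_closed:
  "m \<in> M_S D s S x \<Longrightarrow> incl D S x m \<in> carrier (Mbar D s S)"
  by (auto simp: Mbar_simps incl_def M_S_closed)

lemma incl_apply: "x \<in> Ob D \<Longrightarrow> incl D S x m x = m"
  by (simp add: incl_def)

lemma incl_eq_iff: "x \<in> Ob D \<Longrightarrow> incl D S x m = incl D S x n \<longleftrightarrow> m = n"
  by (metis incl_apply)

text \<open>Any lift of \<open>fmor s f\<close> has the same ends as \<open>f\<close>, so the only
  summand on which it can act non-trivially is the one at \<open>Dom D f\<close>. The value there
  does not depend on the lift, by the definition of \<open>M_S\<close>.\<close>

lemma act_eq:
  assumes f: "f \<in> Mor D" and a: "a \<in> carrier (Mbar D s S)"
  shows "act D s S (fmor s f) a = incl D S (Cod D f) (S_map f (a (Dom D f)))"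
proof -
  let ?x = "Dom D f" and ?v = "incl D S (Cod D f) (S_map f (a (Dom D f)))"
  interpret A: abelian_monoid "Mbar D s S" by (rule abelian_monoid_Mbar)
  have x: "?x \<in> Ob D" using f by (rule source.Dom_closed)
  then have ax: "a ?x \<in> M_S D s S ?x" using a by (auto simp: Mbar_simps)
  have v: "?v \<in> carrier (Mbar D s S)" by (intro incl_closed S_map_M_S f ax)
  have terms: "act_comp D s S (fmor s f) z (a z) = (if ?x = z then ?v else \<zero>\<^bsub>Mbar D s S\<^esub>)"
    if "z \<in> Ob D" for z
  proof (cases "z = ?x")
    case True
    \<comment> \<open>This is the lift selected inside \<open>act_comp\<close>. It may differ from
      \<open>f\<close>, but it lies in the fibre of \<open>f\<close>.\<close>
    define g where "g = (SOME g. g \<in> Mor D \<and> fmor s g = fmor s f \<and> Dom D g = ?x)"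
    have "g \<in> Mor D \<and> fmor s g = fmor s f \<and> Dom D g = ?x"
      unfolding g_def by (rule someI[of _ f]) (use f in simp)
    then have "incl D S (Cod D g) (S_map g (a ?x)) = ?v"
      using M_S_D[OF ax f, of g] fibreD(4)[OF f, of g] by (simp add: fibre_def)
    then show ?thesis using True f by (auto simp: act_comp_def g_def[symmetric])
  next
    case False
    have "Dom D g \<noteq> z" if "g \<in> Mor D" "fmor s g = fmor s f" for g
      using that False fibreD(3)[OF f, of g] by (simp add: fibre_def)
    then show ?thesis using False by (auto simp: act_comp_def)
  qed
  have "act D s S (fmor s f) a =
      (\<Oplus>\<^bsub>Mbar D s S\<^esub> z \<in> Ob D. if ?x = z then ?v else \<zero>\<^bsub>Mbar D s S\<^esub>)"
    unfolding act_def by (rule A.finsum_cong') (use v terms in auto)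
  also have "\<dots> = ?v"
    using A.finsum_singleton[OF x finite_Ob, of "\<lambda>_. ?v"] v by simp
  finally show ?thesis .
qed

text \<open>The identity of \<open>D\<close> at \<open>x\<close> is a lift of the identity at
  \<open>fob s x\<close>, and \<open>S\<close> sends it to an identity. So the idempotent belonging
  to \<open>fob s x\<close> is the projection onto the summand at \<open>x\<close>.\<close>

lemma act_Ide:
  assumes "x \<in> Ob D" "a \<in> carrier (Mbar D s S)"
  shows "act D s S (Ide C (fob s x)) a = incl D S x (a x)"
proof -
  have "a x \<in> carrier (fob S x)" using assms by (auto simp: Mbar_simps intro: M_S_carrier)
  then show ?thesis
    using act_eq[OF source.Ide_closed assms(2)] assms(1)
    by (simp add: s.fmor_Ide source.Dom_Ide source.Cod_Ide S_map_Ide)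
qed

lemma act_incl:
  assumes "f \<in> Mor D" "m \<in> M_S D s S (Dom D f)"
  shows "act D s S (fmor s f) (incl D S (Dom D f) m) = incl D S (Cod D f) (S_map f m)"
  using assms by (simp add: act_eq incl_closed incl_apply source.Dom_closed)

section \<open>Values of the induced functor as algebras, and its maps as homomorphisms\<close>

lemma IndT_ob_carrier:
  assumes "x \<in> Ob D"
  shows "carrier (IndT_ob C D s S (fob s x)) = incl D S x ` M_S D s S x"
proof -
  have "\<exists>a\<in>carrier (Mbar D s S). a x = m" if "m \<in> M_S D s S x" for m
    using that incl_closed incl_apply assms by blast
  moreover have "a x \<in> M_S D s S x" if "a \<in> carrier (Mbar D s S)" for a
    using that assms by (auto simp: Mbar_simps)
  ultimately show ?thesis
    by (auto simp: IndT_ob_def act_Ide[OF assms] image_iff)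
qed

text \<open>With \<open>IndT_ob_carrier\<close>, this identifies the value at \<open>fob s x\<close>
  with the algebra \<open>M_S D s S x\<close>. The unit is the projection of the unit family, hence
  concentrated at \<open>x\<close>.\<close>

lemma IndT_ob_ops:
  assumes x: "x \<in> Ob D"
  defines "B \<equiv> IndT_ob C D s S (fob s x)"
  shows "\<one>\<^bsub>B\<^esub> = incl D S x \<one>\<^bsub>fob S x\<^esub>"
    and "\<zero>\<^bsub>B\<^esub> = incl D S x \<zero>\<^bsub>fob S x\<^esub>"
    and "\<lbrakk>a \<in> M_S D s S x; b \<in> M_S D s S x\<rbrakk> \<Longrightarrow>
      incl D S x a \<oplus>\<^bsub>B\<^esub> incl D S x b = incl D S x (a \<oplus>\<^bsub>fob S x\<^esub> b)"
    and "\<lbrakk>a \<in> M_S D s S x; b \<in> M_S D s S x\<rbrakk> \<Longrightarrow>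
      incl D S x a \<otimes>\<^bsub>B\<^esub> incl D S x b = incl D S x (a \<otimes>\<^bsub>fob S x\<^esub> b)"
    and "\<lbrakk>c \<in> carrier K; a \<in> M_S D s S x\<rbrakk> \<Longrightarrow>
      c \<odot>\<^bsub>B\<^esub> incl D S x a = incl D S x (c \<odot>\<^bsub>fob S x\<^esub> a)"
proof -
  show "\<one>\<^bsub>B\<^esub> = incl D S x \<one>\<^bsub>fob S x\<^esub>"
    using act_Ide[OF x one_Mbar_closed] x by (simp add: B_def IndT_ob_def Mbar_simps)
  show "\<zero>\<^bsub>B\<^esub> = incl D S x \<zero>\<^bsub>fob S x\<^esub>"
    by (auto simp: B_def IndT_ob_def Mbar_simps incl_def)
  \<comment> \<open>At objects other than \<open>x\<close> both families are zero, so the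
    componentwise operations there only combine zeros.\<close>
  have z: "\<zero>\<^bsub>fob S z\<^esub> \<oplus>\<^bsub>fob S z\<^esub> \<zero>\<^bsub>fob S z\<^esub> = \<zero>\<^bsub>fob S z\<^esub>"
    "\<zero>\<^bsub>fob S z\<^esub> \<otimes>\<^bsub>fob S z\<^esub> \<zero>\<^bsub>fob S z\<^esub> = \<zero>\<^bsub>fob S z\<^esub>"
    "c \<in> carrier K \<Longrightarrow> c \<odot>\<^bsub>fob S z\<^esub> \<zero>\<^bsub>fob S z\<^esub> = \<zero>\<^bsub>fob S z\<^esub>" if "z \<in> Ob D" for z c
  proof -
    interpret R: ring "fob S z" using that by (rule ring_S)
    interpret M: module K "fob S z" using that by (rule module_S)
    show "\<zero>\<^bsub>fob S z\<^esub> \<oplus>\<^bsub>fob S z\<^esub> \<zero>\<^bsub>fob S z\<^esub> = \<zero>\<^bsub>fob S z\<^esub>"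
      "\<zero>\<^bsub>fob S z\<^esub> \<otimes>\<^bsub>fob S z\<^esub> \<zero>\<^bsub>fob S z\<^esub> = \<zero>\<^bsub>fob S z\<^esub>"
      "c \<in> carrier K \<Longrightarrow> c \<odot>\<^bsub>fob S z\<^esub> \<zero>\<^bsub>fob S z\<^esub> = \<zero>\<^bsub>fob S z\<^esub>"
      by simp_all
  qed
  show "incl D S x a \<oplus>\<^bsub>B\<^esub> incl D S x b = incl D S x (a \<oplus>\<^bsub>fob S x\<^esub> b)"
    by (auto simp: B_def IndT_ob_def Mbar_simps incl_def z intro!: restrict_ext)
  show "incl D S x a \<otimes>\<^bsub>B\<^esub> incl D S x b = incl D S x (a \<otimes>\<^bsub>fob S x\<^esub> b)"
    by (auto simp: B_def IndT_ob_def Mbar_simps incl_def z intro!: restrict_ext)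
  show "c \<odot>\<^bsub>B\<^esub> incl D S x a = incl D S x (c \<odot>\<^bsub>fob S x\<^esub> a)" if "c \<in> carrier K"
    using that by (auto simp: B_def IndT_ob_def Mbar_simps incl_def z intro!: restrict_ext)
qed

lemma k_algebra_IndT_ob:
  assumes "x \<in> Ob D"
  shows "k_algebra K (IndT_ob C D s S (fob s x))"
  by (rule k_algebra_image[OF k_algebra_S[OF assms], where N = "M_S D s S x" and \<phi> = "incl D S x"])
    (auto simp: M_S_closed[OF assms] M_S_carrier IndT_ob_carrier[OF assms] IndT_ob_ops[OF assms])

text \<open>Under the identification of the values with \<open>M_S\<close>, the action of
  \<open>fmor s f\<close> is the restriction of the homomorphism \<open>S_map f\<close>. In
  particular it takes the unit at \<open>Dom D f\<close> to the unit at
  \<open>Cod D f\<close>.\<close>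

lemma act_hom:
  assumes f: "f \<in> Mor D"
  defines "A \<equiv> IndT_ob C D s S (fob s (Dom D f))" and "B \<equiv> IndT_ob C D s S (fob s (Cod D f))"
  shows "(\<lambda>m \<in> carrier A. act D s S (fmor s f) m) \<in> k_algebra_hom K A B"
proof -
  have x: "Dom D f \<in> Ob D" and y: "Cod D f \<in> Ob D"
    using f by (simp_all add: source.Dom_closed source.Cod_closed)
  note simps = A_def B_def IndT_ob_carrier[OF x] IndT_ob_carrier[OF y] IndT_ob_ops[OF x]
    IndT_ob_ops[OF y] M_S_closed[OF x] act_incl[OF f] S_map_M_S[OF f] S_map_simps[OF f] M_S_carrier
    incl_eq_iff[OF x]
  show ?thesis
    by (auto simp: k_algebra_hom_def ring_hom_def simps)
qed

section \<open>Lifting along \<open>s\<close> and functoriality\<close>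

text \<open>Surjectivity on morphisms gives a lift of the identity at \<open>x'\<close>, and the
  domain of that lift lies above \<open>x'\<close>.\<close>

lemma Ob_surj:
  assumes "x' \<in> Ob C"
  obtains x where "x \<in> Ob D" "x' = fob s x"
proof -
  obtain f where "f \<in> Mor D" "fmor s f = Ide C x'"
    using target.Ide_closed[OF assms] surj_Mor by (metis imageE)
  then show ?thesis
    using that[of "Dom D f"] s.fmor_Dom[of f] target.Dom_Ide[OF assms] source.Dom_closed by simp
qed

lemma Mor_surj:
  assumes "h \<in> Mor C"
  obtains f where "f \<in> Mor D" "h = fmor s f"
  using assms surj_Mor by (metis imageE)

lemma precosheaf_IndT: "precosheaf K C (IndT C D s S)"
proof (intro covariant_functor.intro covariant_functor_axioms.intro category_kAlg
    target.category_axioms)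
  show "fob (IndT C D s S) x' \<in> Ob (kAlg K)" if x': "x' \<in> Ob C" for x'
  proof -
    obtain x where "x \<in> Ob D" "x' = fob s x" by (rule Ob_surj[OF x'])
    then show ?thesis by (simp add: IndT_def kAlg_def k_algebra_IndT_ob)
  qed
  show "fmor (IndT C D s S) h \<in> Mor (kAlg K)" if h: "h \<in> Mor C" for h
  proof -
    obtain f where f: "f \<in> Mor D" "h = fmor s f" by (rule Mor_surj[OF h])
    then show ?thesis
      using act_hom[OF f(1)]
      by (simp add: IndT_def kAlg_def k_algebra_IndT_ob s.fmor_Dom s.fmor_Cod
          source.Dom_closed source.Cod_closed)
  qed
  show "Dom (kAlg K) (fmor (IndT C D s S) h) = fob (IndT C D s S) (Dom C h)"
    "Cod (kAlg K) (fmor (IndT C D s S) h) = fob (IndT C D s S) (Cod C h)" for h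
    by (simp_all add: IndT_def kAlg_def)
  show "fmor (IndT C D s S) (Ide C x') = Ide (kAlg K) (fob (IndT C D s S) x')"
    if x': "x' \<in> Ob C" for x'
  proof -
    obtain x where x: "x \<in> Ob D" "x' = fob s x" by (rule Ob_surj[OF x'])
    \<comment> \<open>The identity projects onto the summand in which \<open>m\<close> is already
      concentrated.\<close>
    have "act D s S (Ide C x') m = m" if "m \<in> carrier (IndT_ob C D s S x')" for m
      using that x by (auto simp: IndT_ob_carrier act_Ide incl_closed incl_apply)
    then show ?thesis
      using x' by (auto simp: IndT_def kAlg_def target.Dom_Ide target.Cod_Ide intro!: restrict_ext)
  qed
  show "fmor (IndT C D s S) (Comp C h' h) =
      Comp (kAlg K) (fmor (IndT C D s S) h') (fmor (IndT C D s S) h)"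
    if h: "h \<in> Mor C" and h': "h' \<in> Mor C" and hh': "Dom C h' = Cod C h" for h h'
  proof -
    obtain f where f: "f \<in> Mor D" "h = fmor s f" by (rule Mor_surj[OF h])
    obtain g where g: "g \<in> Mor D" "h' = fmor s g" by (rule Mor_surj[OF h'])
    \<comment> \<open>The lifts are chosen separately, but their middle objects have the same image
      under \<open>s\<close>; injectivity on objects makes the lifts composable, so functoriality of
      \<open>S\<close> applies.\<close>
    have gf: "Dom D g = Cod D f"
      using hh' f g inj_Ob by (simp add: s.fmor_Dom s.fmor_Cod inj_on_eq_iff
          source.Dom_closed source.Cod_closed)
    have x: "Dom D f \<in> Ob D" and y: "Cod D f \<in> Ob D"
      using f by (simp_all add: source.Dom_closed source.Cod_closed)
    let ?A = "IndT_ob C D s S (fob s (Dom D f))" and ?B = "IndT_ob C D s S (fob s (Cod D f))"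
    \<comment> \<open>The membership half is needed because the second arrow agrees with the action
      only on its own carrier.\<close>
    have "act D s S h m \<in> carrier ?B \<and> act D s S (Comp C h' h) m = act D s S h' (act D s S h m)"
      if m: "m \<in> carrier ?A" for m
    proof -
      obtain n where n: "n \<in> M_S D s S (Dom D f)" "m = incl D S (Dom D f) n"
        using m IndT_ob_carrier[OF x] by auto
      have hm: "act D s S h m = incl D S (Cod D f) (S_map f n)"
        using act_incl[OF f(1)] n f by simp
      have "act D s S (fmor s (Comp D g f)) m = incl D S (Cod D g) (S_map (Comp D g f) n)"
        using act_incl[OF source.Comp_closed[OF f(1) g(1) gf]] n f(1) g(1) gf
        by (simp add: source.Dom_Comp source.Cod_Comp)
      moreover have "act D s S h' (act D s S h m) = incl D S (Cod D g) (S_map g (S_map f n))"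
        using act_incl[OF g(1)] S_map_M_S[OF f(1) n(1)] g gf hm by simp
      ultimately show ?thesis
        using f g gf n hm S_map_M_S[OF f(1) n(1)]
        by (simp add: S_map_Comp M_S_carrier s.fmor_Comp IndT_ob_carrier[OF y])
    qed
    then show ?thesis
      using h h' hh' f
      by (auto simp: IndT_def kAlg_def target.Dom_Comp target.Cod_Comp s.fmor_Dom s.fmor_Cod
          compose_def intro!: restrict_ext)
  qed
qed

end

theorem proposition3p7:
  fixes K :: "('k, 'c) ring_scheme"
    and C :: "('p, 'n) cat"
    and D :: "('o, 'm) cat"
    and S :: "('o, 'm, ('k, 'a) module, ('k, 'a) arr) fun_data"
    and s :: "('o, 'm, 'p, 'n) fun_data"
  assumes "field K"
    and "finite_category C"
    and "finite_category D"
    and "precosheaf K D S"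
    and "covariant_functor D C s"
    and "inj_on (fob s) (Ob D)"
    and "fmor s ` Mor D = Mor C"
  shows "precosheaf K C (IndT C D s S)"
proof -
  interpret D: finite_category D by fact
  interpret C: finite_category C by fact
  \<comment> \<open>Each object is the domain of its identity, so finitely many morphisms leave only
    finitely many objects.\<close>
  have "Ob D \<subseteq> Dom D ` Mor D"
    using D.Ide_closed D.Dom_Ide by (metis image_eqI subsetI)
  then have "finite (Ob D)"
    using D.finite_Mor by (metis finite_imageI finite_subset)
  then interpret turull_induction K C D S s
    using assms by (simp add: turull_induction_def turull_induction_axioms_def
        D.category_axioms C.category_axioms)
  show ?thesis by (rule precosheaf_IndT)
qed

end
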